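(* For $d\in\mathbb{N}$ and $a\in\mathbb{N}$ let $\Lambda_d(a)=\{x\in\mathbb{Z}^d: x_1\equiv x_2\equiv\cdots\equiv x_d \pmod a\}$. Then for all $a\in\mathbb{N}$, $\operatorname{xc}(\operatorname{VC}(\Lambda_d(a)))\in\mathcal{O}(d^3)$.
   Context: The Voronoi cell of a lattice $\Lambda\subseteq\mathbb{R}^d$ is $\operatorname{VC}(\Lambda)=\{x\in\operatorname{lin}(\Lambda): \|x\|\le\|x-z\| \text{ for all } z\in\Lambda\}$, where $\operatorname{lin}$ denotes linear hull and $\|\cdot\|$ the Euclidean norm. For a polytope $P$, the extension complexity $\operatorname{xc}(P)$ is the minimum number of facets of any polyhedron that can be mapped onto $P$ by a linear map. *)

theory Defs
  imports
    "HOL-Analysis.Analysis"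
    "HOL-Analysis.Finite_Function_Topology"
    "HOL-Number_Theory.Cong"
    "HOL-Library.Extended_Nat"
begin

text \<open>
  The dimension has to vary inside the statement (both \<^term>\<open>d\<close> and the dimension of the lifts), so
  all the spaces \<open>\<real>\<^sup>n\<close> are realised inside the real vector space \<^typ>\<open>nat \<Rightarrow>\<^sub>0 real\<close> of finitely
  supported sequences, \<open>\<real>\<^sup>n\<close> being the vectors supported on the coordinates \<open>0, \<dots>, n - 1\<close>.
  The library's \<^const>\<open>norm\<close> on this type is the sum norm and hence is not used below.
\<close>

type_synonym rvec = "nat \<Rightarrow>\<^sub>0 real"

definition Rn :: "nat \<Rightarrow> rvec set" where
  "Rn n = {x. Poly_Mapping.keys x \<subseteq> {..<n}}"

text \<open>Both sums range over the support of \<open>x\<close>; the terms outside it are zero.\<close>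

definition dotp :: "rvec \<Rightarrow> rvec \<Rightarrow> real" where
  "dotp x y = (\<Sum>i\<in>Poly_Mapping.keys x. Poly_Mapping.lookup x i * Poly_Mapping.lookup y i)"

definition enorm :: "rvec \<Rightarrow> real" where
  "enorm x = L2_set (Poly_Mapping.lookup x) (Poly_Mapping.keys x)"

definition voronoi_cell :: "rvec set \<Rightarrow> rvec set" where
  "voronoi_cell L = {x \<in> span L. \<forall>z\<in>L. enorm x \<le> enorm (x - z)}"

definition Lambda :: "nat \<Rightarrow> nat \<Rightarrow> rvec set" where
  "Lambda d a = {x \<in> Rn d. \<exists>z :: nat \<Rightarrow> int.
     (\<forall>i<d. Poly_Mapping.lookup x i = of_int (z i)) \<and>
     (\<forall>i<d. \<forall>j<d. [z i = z j] (mod int a))}"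

definition polyhedron_in :: "nat \<Rightarrow> rvec set \<Rightarrow> bool" where
  "polyhedron_in n Q \<longleftrightarrow> (\<exists>H. finite H \<and> H \<subseteq> Rn n \<times> (UNIV :: real set) \<and>
     Q = {x \<in> Rn n. \<forall>(c, b)\<in>H. dotp c x \<le> b})"

text \<open>
  Dimension of the affine hull of a nonempty set, as the dimension of its direction space
  (the library's \<^const>\<open>aff_dim\<close> and \<^const>\<open>facet_of\<close> are restricted to Euclidean spaces).
\<close>

definition affdim :: "rvec set \<Rightarrow> nat" where
  "affdim S = dim {x - y |x y. x \<in> S \<and> y \<in> S}"

definition facets :: "rvec set \<Rightarrow> rvec set set" where
  "facets Q = {F. F face_of Q \<and> F \<noteq> {} \<and> affdim F + 1 = affdim Q}"

text \<open>
  Every linear map on \<open>\<real>\<^sup>n\<close> extends to \<^typ>\<open>rvec\<close>, so globally linear maps suffice. The infimum is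
  taken in \<^typ>\<open>enat\<close>, so that a set without any polyhedral lift gets the value \<open>\<infinity>\<close> and a finite
  bound on \<open>xc\<close> includes the existence of a lift.
\<close>

definition xc :: "rvec set \<Rightarrow> enat" where
  "xc P = Inf {enat (card (facets Q)) |n Q f.
     polyhedron_in n Q \<and> linear (f :: rvec \<Rightarrow> rvec) \<and> f ` Q = P}"

end

theory Submission
  imports Defs
begin

text \<open>
  The lattice is the union of the cosets \<open>k + a \<int>\<^sup>d\<close> of its sublattice \<open>a \<int>\<^sup>d\<close>, where \<open>k\<close> stands for
  the constant vector. For \<open>x\<close> in the cube of side \<open>a\<close> around the origin and \<open>0 \<le> k < a\<close>, the
  inequalities \<open>0 \<le> \<parallel>z\<parallel>\<^sup>2 - 2 z \<bullet> x\<close> for all \<open>z\<close> in the coset amount to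
  \<open>0 \<le> \<Sum>i. min (k\<^sup>2 - 2 k x\<^sub>i) ((k - a)\<^sup>2 - 2 (k - a) x\<^sub>i)\<close>, which has a lift with \<open>2 d + 1\<close>
  inequalities. The number of cosets is not bounded in terms of \<open>d\<close>, but \<open>3 (d + 1)\<close> values of \<open>k\<close>
  imply the others: if the second term is chosen in \<open>m\<close> coordinates, the sum is a quadratic
  polynomial in \<open>k\<close>, and the inequalities for \<open>k = \<plusminus>1\<close> force its minimum to be at distance at most
  \<open>1 / 2\<close> from \<open>m a / d\<close>. The number of facets of a polyhedron is at most the number of inequalities describing it.
\<close>

section \<open>Coordinates, bases and dimension in \<open>Rn n\<close>\<close>

lemma lookup_scaleR [simp]:
  "Poly_Mapping.lookup (r *\<^sub>R x) i = r * Poly_Mapping.lookup (x :: rvec) i"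
proof -
  have "finite {i. r *\<^sub>R Poly_Mapping.lookup x i \<noteq> 0}"
    by (rule finite_subset[OF _ finite_lookup[of x]]) auto
  then show ?thesis
    by (simp add: scaleR_poly_mapping_def Abs_poly_mapping_inverse)
qed

lemma lookup_sum [simp]:
  "Poly_Mapping.lookup (\<Sum>i\<in>A. f i :: rvec) j = (\<Sum>i\<in>A. Poly_Mapping.lookup (f i) j)"
  by (induction A rule: infinite_finite_induct) (simp_all add: lookup_add)

lemma linear_lookup: "linear (\<lambda>x :: rvec. Poly_Mapping.lookup x i)"
  by (rule linearI) (simp_all add: lookup_add)

lemma mem_Rn_iff: "x \<in> Rn n \<longleftrightarrow> (\<forall>i\<ge>n. Poly_Mapping.lookup x i = 0)"
  by (simp add: Rn_def subset_eq Ball_def in_keys_iff) (metis not_le)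

lemma subspace_Rn: "subspace (Rn n)"
  by (auto simp: subspace_def mem_Rn_iff lookup_add)

definition rvec_of :: "nat \<Rightarrow> (nat \<Rightarrow> real) \<Rightarrow> rvec" where
  "rvec_of n g = (\<Sum>i<n. Poly_Mapping.single i (g i))"

lemma lookup_rvec_of [simp]: "Poly_Mapping.lookup (rvec_of n g) i = (if i < n then g i else 0)"
  by (simp add: rvec_of_def lookup_single when_def sum.delta)

lemma rvec_of_in_Rn [simp]: "rvec_of n g \<in> Rn n"
  by (simp add: mem_Rn_iff)

lemma linear_rvec_of:
  assumes "\<And>i. i < n \<Longrightarrow> linear (\<phi> i :: rvec \<Rightarrow> real)"
  shows "linear (\<lambda>x. rvec_of n (\<lambda>i. \<phi> i x))"
  by (rule linearI; rule poly_mapping_eqI)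
    (simp_all add: lookup_add linear_add[OF assms] linear_cmul[OF assms])

lemma dotp_eq_sum:
  assumes "c \<in> Rn n"
  shows "dotp c x = (\<Sum>i<n. Poly_Mapping.lookup c i * Poly_Mapping.lookup x i)"
  unfolding dotp_def using assms
  by (intro sum.mono_neutral_left) (auto simp: Rn_def in_keys_iff)

lemma linear_dotp: "linear (dotp c)"
  by (rule linearI)
    (simp_all add: dotp_def lookup_add sum.distrib sum_distrib_left algebra_simps)

lemma dotp_uminus_left: "dotp (- c) x = - dotp c x"
proof -
  have "Poly_Mapping.keys (- c) = Poly_Mapping.keys c"
    by (auto simp: in_keys_iff)
  then show ?thesis
    by (simp add: dotp_def sum_negf)
qed

lemma Rn_expansion:
  assumes "x \<in> Rn n"
  shows "x = (\<Sum>i<n. Poly_Mapping.lookup x i *\<^sub>R Poly_Mapping.single i 1)"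
proof (rule poly_mapping_eqI)
  fix k
  have "Poly_Mapping.lookup (\<Sum>i<n. Poly_Mapping.lookup x i *\<^sub>R Poly_Mapping.single i 1) k
      = (\<Sum>i<n. if i = k then Poly_Mapping.lookup x i else 0)"
    unfolding lookup_sum by (rule sum.cong) (auto simp: lookup_single)
  also have "\<dots> = Poly_Mapping.lookup x k"
    using assms unfolding mem_Rn_iff by (cases "k < n") auto
  finally show "Poly_Mapping.lookup x k
      = Poly_Mapping.lookup (\<Sum>i<n. Poly_Mapping.lookup x i *\<^sub>R Poly_Mapping.single i 1) k" ..
qed

lemma Rn_finite_span: "\<exists>B. finite B \<and> Rn n \<subseteq> span B"
proof (intro exI conjI subsetI)
  let ?B = "(\<lambda>i. Poly_Mapping.single i (1 :: real)) ` {..<n}"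
  show "finite ?B" by simp
  fix x assume "x \<in> Rn n"
  then have "x = (\<Sum>i<n. Poly_Mapping.lookup x i *\<^sub>R Poly_Mapping.single i 1)"
    by (rule Rn_expansion)
  also have "\<dots> \<in> span ?B"
    by (intro span_sum span_scale span_base) auto
  finally show "x \<in> span ?B" .
qed

text \<open>The type \<open>rvec\<close> is infinite dimensional, so independent sets are compared
  with \<open>dim\<close> only inside some \<open>Rn n\<close>. Its finite spanning set makes every
  independent subset finite, including a basis of \<open>W\<close>, and the exchange bound against
  that basis gives the count.\<close>

lemma card_le_dim_Rn:
  assumes "independent S" "S \<subseteq> W" "W \<subseteq> Rn n"
  shows "finite S" "card S \<le> dim W"
proof -
  obtain B where B: "finite B" "Rn n \<subseteq> span B"
    using Rn_finite_span by blast
  have fin: "finite T" if "independent T" "T \<subseteq> W" for T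
    using independent_span_bound[OF B(1) that(1)] order_trans[OF that(2) order_trans[OF assms(3) B(2)]]
    by simp
  show "finite S"
    using fin[OF assms(1,2)] .
  obtain T where T: "T \<subseteq> W" "independent T" "W \<subseteq> span T" "card T = dim W"
    by (rule basis_exists)
  show "card S \<le> dim W"
    using independent_span_bound[OF fin[OF T(2,1)] assms(1)] order_trans[OF assms(2) T(3)] T(4)
    by simp
qed

section \<open>Facets of a polyhedron and the inequalities describing it\<close>

definition polyh :: "nat \<Rightarrow> (rvec \<times> real) set \<Rightarrow> rvec set" where
  "polyh n H = {x \<in> Rn n. \<forall>(c, b)\<in>H. dotp c x \<le> b}"

lemma polyhD: "x \<in> polyh n H \<Longrightarrow> (c, b) \<in> H \<Longrightarrow> dotp c x \<le> b"
  by (auto simp: polyh_def)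

text \<open>
  Otherwise averaging yields a point of \<open>F\<close> at which every inequality that is not an equation on
  the whole polyhedron is strict; any point of the polyhedron is the end of a segment through it.
\<close>

lemma proper_face_tight:
  assumes H: "finite H" and F: "F face_of polyh n H" "F \<noteq> {}" "F \<noteq> polyh n H"
  shows "\<exists>(c, b)\<in>H. (\<forall>x\<in>F. dotp c x = b) \<and> (\<exists>y\<in>polyh n H. dotp c y < b)"
proof (rule ccontr)
  assume none: "\<not> ?thesis"
  have no: "\<exists>x\<in>F. dotp c x \<noteq> b" if "(c, b) \<in> H" "y \<in> polyh n H" "dotp c y < b" for c b y
  proof (rule ccontr)
    assume "\<not> (\<exists>x\<in>F. dotp c x \<noteq> b)"
    then have "case (c, b) of (c, b) \<Rightarrow>
        (\<forall>x\<in>F. dotp c x = b) \<and> (\<exists>y\<in>polyh n H. dotp c y < b)"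
      using that by auto
    then show False
      using none that(1) by blast
  qed
  note lin = linear_add[OF linear_dotp] linear_cmul[OF linear_dotp] linear_diff[OF linear_dotp]
  have FQ: "F \<subseteq> polyh n H" and conv: "convex F"
    using F(1) by (auto simp: face_of_def)
  \<comment> \<open>\<open>T\<close> collects the inequalities that are not implicit equations of
    the polyhedron.\<close>
  define T where "T = {(c, b)\<in>H. \<exists>y\<in>polyh n H. dotp c y < b}"
  have TH: "T \<subseteq> H" by (auto simp: T_def)
  have "\<exists>x\<in>F. \<forall>(c, b)\<in>S. dotp c x < b" if "finite S" "S \<subseteq> T" for S
    using that
  proof (induction S rule: finite_induct)
    case empty
    then show ?case using F(2) by blast
  next
    case (insert h S)
    obtain c b where h: "h = (c, b)" by (cases h)
    obtain x where x: "x \<in> F" "\<forall>(c, b)\<in>S. dotp c x < b"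
      using insert by auto
    obtain z where z: "z \<in> F" "dotp c z \<noteq> b"
      using no insert.prems h unfolding T_def by blast
    have le: "dotp c' w \<le> b'" if "(c', b') \<in> T" "w \<in> F" for c' b' w
      using polyhD[OF subsetD[OF FQ that(2)] subsetD[OF TH that(1)]] .
    let ?m = "(1/2) *\<^sub>R x + (1/2) *\<^sub>R z"
    have "?m \<in> F"
      using conv x(1) z(1) unfolding convex_def by simp
    moreover have "dotp c ?m < b"
      using le[of c b x] le[of c b z] x z insert.prems h by (simp add: lin)
    moreover have "dotp c' ?m < b'" if "(c', b') \<in> S" for c' b'
    proof -
      have "dotp c' x < b'" "dotp c' z \<le> b'"
        using that x(2) insert.prems le z(1) by auto
      then show ?thesis by (simp add: lin)
    qed
    ultimately show ?case using h by blast
  qed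
  from this[of T] obtain x where x: "x \<in> F" "\<forall>(c, b)\<in>T. dotp c x < b"
    using H TH finite_subset by blast
  have "y \<in> F" if y: "y \<in> polyh n H" for y
  proof (cases "y = x")
    case False
    \<comment> \<open>Slightly beyond \<open>x\<close>, seen from \<open>y\<close>, no inequality
      fails: those in \<open>T\<close> have slack at \<open>x\<close>, and the others are equations
      on the whole polyhedron, hence constant along the line through \<open>x\<close> and
      \<open>y\<close>.\<close>
    have ev: "\<forall>\<^sub>F e in at_right (0::real). \<forall>h\<in>H. dotp (fst h) (x + e *\<^sub>R (x - y)) \<le> snd h"
    proof (rule eventually_ball_finite[OF H], rule ballI)
      fix h assume hH: "h \<in> H"
      obtain c b where h: "h = (c, b)" by (cases h)
      show "\<forall>\<^sub>F e in at_right (0::real). dotp (fst h) (x + e *\<^sub>R (x - y)) \<le> snd h"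
      proof (cases "h \<in> T")
        case True
        have "((\<lambda>e. dotp c x + e * dotp c (x - y)) \<longlongrightarrow> dotp c x + 0 * dotp c (x - y)) (at_right 0)"
          by (intro tendsto_intros)
        moreover have "dotp c x + 0 * dotp c (x - y) < b"
          using x(2) True h by auto
        ultimately have "\<forall>\<^sub>F e in at_right 0. dotp c x + e * dotp c (x - y) < b"
          by (rule order_tendstoD)
        then show ?thesis
          by (rule eventually_mono) (simp add: h lin)
      next
        case False
        then have "dotp c w = b" if "w \<in> polyh n H" for w
        proof -
          have "(c, b) \<in> H" "\<not> dotp c w < b"
            using False hH that h by (auto simp: T_def)
          then show ?thesis
            using polyhD[OF that, of c b] by simp
        qed
        then have "dotp c x = b" "dotp c y = b"
          using x(1) FQ y by auto
        then show ?thesis by (simp add: h lin)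
      qed
    qed
    obtain e :: real where e: "e > 0" "\<forall>h\<in>H. dotp (fst h) (x + e *\<^sub>R (x - y)) \<le> snd h"
      using eventually_happens[OF eventually_conj[OF ev eventually_at_right_less[of 0]]] by auto
    define w where "w = x + e *\<^sub>R (x - y)"
    have "w \<in> Rn n"
      using x(1) FQ y unfolding w_def polyh_def
      by (intro subspace_add subspace_scale subspace_diff subspace_Rn) auto
    then have w: "w \<in> polyh n H"
      using e(2) by (auto simp: polyh_def w_def)
    \<comment> \<open>A point of the face strictly between \<open>y\<close> and \<open>w\<close>
      forces \<open>y\<close> into the face. The weight \<open>1 / (1 + e)\<close> of
      \<open>w\<close> comes from solving \<open>w = x + e (x - y)\<close> for
      \<open>x\<close>.\<close>
    have "x \<in> open_segment y w"
      unfolding in_segment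
    proof (intro conjI exI)
      have "x - y \<noteq> 0" using False by simp
      then show "y \<noteq> w"
      proof -
        have "w - y = (1 + e) *\<^sub>R (x - y)" by (simp add: w_def algebra_simps)
        then show ?thesis using \<open>x - y \<noteq> 0\<close> e(1) by auto
      qed
      show "0 < 1 / (1 + e)" "1 / (1 + e) < 1" using e(1) by auto
      have "(1 + e) *\<^sub>R ((1 - 1 / (1 + e)) *\<^sub>R y + (1 / (1 + e)) *\<^sub>R w) = e *\<^sub>R y + w"
        using e(1) by (simp add: scaleR_add_right field_simps)
      also have "\<dots> = (1 + e) *\<^sub>R x"
        by (simp add: w_def algebra_simps)
      finally show "x = (1 - 1 / (1 + e)) *\<^sub>R y + (1 / (1 + e)) *\<^sub>R w"
        using e(1) by simp
    qed
    then show ?thesis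
      using F(1) x(1) y w unfolding face_of_def by blast
  qed (use x in simp)
  then show False using FQ F(3) by blast
qed

text \<open>Some inequality is tight on \<open>F\<close> but not on the whole polyhedron. If its
  tight set were larger than \<open>F\<close>, a second inequality would be tight on
  \<open>F\<close> but not on that set, and the dimension would drop by at least two, which a facet
  excludes.\<close>

lemma facet_eq_tight:
  assumes H: "finite H" "H \<subseteq> Rn n \<times> UNIV" and F: "F \<in> facets (polyh n H)"
  shows "\<exists>(c, b)\<in>H. F = {x \<in> polyh n H. dotp c x = b}"
proof -
  note lin = linear_diff[OF linear_dotp]
  let ?Q = "polyh n H"
  have face: "F face_of ?Q" "F \<noteq> {}" and dims: "affdim F + 1 = affdim ?Q"
    using F by (auto simp: facets_def)
  have "F \<noteq> ?Q" using dims by auto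
  then obtain c b where c: "(c, b) \<in> H" "\<forall>x\<in>F. dotp c x = b" "\<exists>y\<in>?Q. dotp c y < b"
    using proper_face_tight[OF H(1) face] by blast
  \<comment> \<open>Adding the reversed inequality presents the tight set as a polyhedron, so that
    \<open>proper_face_tight\<close> applies once more.\<close>
  define H' where "H' = insert (- c, - b) H"
  have G: "{x \<in> ?Q. dotp c x = b} = polyh n H'"
  proof (rule set_eqI)
    fix x
    have "dotp c x \<le> b" if "x \<in> polyh n H"
      using polyhD[OF that c(1)] .
    then show "x \<in> {x \<in> ?Q. dotp c x = b} \<longleftrightarrow> x \<in> polyh n H'"
      by (auto simp: polyh_def H'_def dotp_uminus_left)
  qed
  have FG: "F \<subseteq> polyh n H'" and GQ: "polyh n H' \<subseteq> ?Q"
    using G c(2) face(1) by (auto simp: face_of_def)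
  have "F = polyh n H'"
  proof (rule ccontr)
    assume "F \<noteq> polyh n H'"
    then obtain c' b' where c': "\<forall>x\<in>F. dotp c' x = b'" "\<exists>y\<in>polyh n H'. dotp c' y < b'"
      using proper_face_tight[of H' F n] face_of_subset[OF face(1) FG GQ] face(2) H(1)
      unfolding H'_def by blast
    obtain y' where y': "y' \<in> polyh n H'" "dotp c' y' < b'" using c'(2) by blast
    obtain y where y: "y \<in> ?Q" "dotp c y < b" using c(3) by blast
    obtain x where x: "x \<in> F" using face(2) by blast
    define D where "D S = {x - y |x y. x \<in> S \<and> y \<in> S}" for S :: "rvec set"
    have "D ?Q \<subseteq> Rn n"
      by (auto simp: D_def polyh_def intro: subspace_diff[OF subspace_Rn])
    have "D F \<subseteq> D ?Q" using FG GQ by (auto simp: D_def)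
    obtain B where B: "B \<subseteq> D F" "independent B" "D F \<subseteq> span B" "card B = dim (D F)"
      by (rule basis_exists)
    have B0: "dotp c z = 0" "dotp c' z = 0" if "z \<in> B" for z
      using that B(1) c(2) c'(1) by (auto simp: D_def lin)
    \<comment> \<open>Both functionals vanish on \<open>B\<close>; \<open>c\<close> vanishes at
      \<open>y' - x\<close> but not at \<open>y - x\<close>, and \<open>c'\<close> does not vanish
      at \<open>y' - x\<close>. By this triangular pattern both vectors extend the basis
      \<open>B\<close> of the directions of \<open>F\<close>.\<close>
    have u: "y' - x \<in> D ?Q" "dotp c (y' - x) = 0" "dotp c' (y' - x) \<noteq> 0"
      using y' x FG GQ G[symmetric] c'(1) by (auto simp: D_def lin)
    have v: "y - x \<in> D ?Q" "dotp c (y - x) \<noteq> 0"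
      using y x FG GQ c(2) by (auto simp: D_def lin)
    have u_nin: "y' - x \<notin> span B"
      using linear_eq_0_on_span[OF linear_dotp, of B c'] B0 u(3) by blast
    have v_nin: "y - x \<notin> span (insert (y' - x) B)"
      using linear_eq_0_on_span[OF linear_dotp, of "insert (y' - x) B" c] B0 u(2) v(2) by blast
    let ?S = "insert (y - x) (insert (y' - x) B)"
    have ind: "independent ?S"
      using B(2) u_nin v_nin by (intro independent_insertI)
    have sub: "?S \<subseteq> D ?Q" using u(1) v(1) B(1) \<open>D F \<subseteq> D ?Q\<close> by auto
    have "finite B" "card ?S \<le> dim (D ?Q)"
      using card_le_dim_Rn[OF ind sub \<open>D ?Q \<subseteq> Rn n\<close>] by auto
    moreover have "y' - x \<notin> B" "y - x \<notin> insert (y' - x) B"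
      using u_nin v_nin span_base by blast+
    ultimately have "dim (D F) + 2 \<le> dim (D ?Q)"
      using B(4) by simp
    then show False using dims by (simp add: affdim_def D_def)
  qed
  then show ?thesis
    using c(1) by (intro bexI[of _ "(c, b)"]) (simp_all add: G)
qed

lemma card_facets_le:
  assumes "finite H" "H \<subseteq> Rn n \<times> UNIV"
  shows "card (facets (polyh n H)) \<le> card H"
proof -
  have "facets (polyh n H) \<subseteq> (\<lambda>(c, b). {x \<in> polyh n H. dotp c x = b}) ` H"
    using facet_eq_tight[OF assms] by fast
  then show ?thesis
    using assms(1) surj_card_le by blast
qed

text \<open>Stated for an indexed family of linear functionals, so that lifts can be written down
  without coefficient vectors; those are recovered from the values at the unit vectors.\<close>

lemma xc_le_card:
  assumes I: "finite I" and \<phi>: "\<And>i. i \<in> I \<Longrightarrow> linear (\<phi> i :: rvec \<Rightarrow> real)"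
    and f: "linear f" "P = f ` {x \<in> Rn n. \<forall>i\<in>I. \<phi> i x \<le> b i}"
  shows "xc P \<le> enat (card I)"
proof -
  define c where "c i = rvec_of n (\<lambda>j. \<phi> i (Poly_Mapping.single j 1))" for i
  define H where "H = (\<lambda>i. (c i, b i)) ` I"
  have H: "finite H" "H \<subseteq> Rn n \<times> UNIV"
    using I by (auto simp: H_def c_def)
  have dot: "dotp (c i) x = \<phi> i x" if "i \<in> I" "x \<in> Rn n" for i x
  proof -
    have "\<phi> i x = \<phi> i (\<Sum>j<n. Poly_Mapping.lookup x j *\<^sub>R Poly_Mapping.single j 1)"
      using Rn_expansion[OF that(2)] by simp
    also have "\<dots> = (\<Sum>j<n. Poly_Mapping.lookup x j * \<phi> i (Poly_Mapping.single j 1))"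
      using \<phi>[OF that(1)] by (simp add: linear_sum linear_cmul)
    also have "\<dots> = dotp (c i) x"
      by (simp add: dotp_eq_sum[of _ n] c_def mult.commute)
    finally show ?thesis by simp
  qed
  have Q: "{x \<in> Rn n. \<forall>i\<in>I. \<phi> i x \<le> b i} = polyh n H"
    using dot by (auto simp: polyh_def H_def)
  have "polyhedron_in n (polyh n H)"
    unfolding polyhedron_in_def using H by (intro exI[of _ H]) (simp add: polyh_def)
  moreover have "f ` polyh n H = P"
    using f(2) Q by simp
  ultimately have "xc P \<le> enat (card (facets (polyh n H)))"
    unfolding xc_def using f(1)
    by (intro Inf_lower CollectI exI[of _ n] exI[of _ "polyh n H"] exI[of _ f]) simp
  also have "\<dots> \<le> enat (card I)"
    using card_facets_le[OF H] card_image_le[OF I, of "\<lambda>i. (c i, b i)"] by (simp add: H_def)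
  finally show ?thesis .
qed

section \<open>The Voronoi cell of \<open>Lambda d a\<close> in coordinates\<close>

lemma enorm_eq:
  assumes "x \<in> Rn d"
  shows "enorm x = sqrt (\<Sum>i<d. (Poly_Mapping.lookup x i)\<^sup>2)"
proof -
  have "(\<Sum>i\<in>Poly_Mapping.keys x. (Poly_Mapping.lookup x i)\<^sup>2) = (\<Sum>i<d. (Poly_Mapping.lookup x i)\<^sup>2)"
    using assms by (intro sum.mono_neutral_left) (simp_all add: Rn_def in_keys_iff)
  then show ?thesis
    by (simp add: enorm_def L2_set_def)
qed

text \<open>After squaring, the quadratic terms in \<open>x\<close> cancel, which leaves a condition
  that is linear in \<open>x\<close> and a sum over coordinates.\<close>

lemma enorm_le_iff:
  assumes "x \<in> Rn d" "z \<in> Rn d"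
  shows "enorm x \<le> enorm (x - z) \<longleftrightarrow>
    0 \<le> (\<Sum>i<d. (Poly_Mapping.lookup z i)\<^sup>2 - 2 * Poly_Mapping.lookup z i * Poly_Mapping.lookup x i)"
proof -
  have "(\<Sum>i<d. (Poly_Mapping.lookup (x - z) i)\<^sup>2) =
      (\<Sum>i<d. (Poly_Mapping.lookup x i)\<^sup>2 +
        ((Poly_Mapping.lookup z i)\<^sup>2 - 2 * Poly_Mapping.lookup z i * Poly_Mapping.lookup x i))"
    by (rule sum.cong) (simp_all add: lookup_minus power2_eq_square algebra_simps)
  then show ?thesis
    unfolding enorm_eq[OF assms(1)] enorm_eq[OF subspace_diff[OF subspace_Rn assms]]
    by (simp add: sum.distrib)
qed

lemma rvec_of_in_Lambda_iff:
  "rvec_of d (\<lambda>i. of_int (z i)) \<in> Lambda d a \<longleftrightarrow> (\<forall>i<d. \<forall>j<d. [z i = z j] (mod int a))"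
proof
  assume "rvec_of d (\<lambda>i. of_int (z i)) \<in> Lambda d a"
  then obtain y where "\<forall>i<d. (of_int (z i) :: real) = of_int (y i)"
    "\<forall>i<d. \<forall>j<d. [y i = y j] (mod int a)"
    by (auto simp: Lambda_def)
  then show "\<forall>i<d. \<forall>j<d. [z i = z j] (mod int a)"
    by (metis of_int_eq_iff)
qed (auto simp: Lambda_def)

lemma LambdaE:
  assumes "x \<in> Lambda d a"
  obtains z where "x = rvec_of d (\<lambda>i. of_int (z i))" "\<forall>i<d. \<forall>j<d. [z i = z j] (mod int a)"
proof -
  obtain z :: "nat \<Rightarrow> int" where x: "x \<in> Rn d" "\<forall>i<d. Poly_Mapping.lookup x i = of_int (z i)"
    and z: "\<forall>i<d. \<forall>j<d. [z i = z j] (mod int a)"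
    using assms by (auto simp: Lambda_def)
  have "x = rvec_of d (\<lambda>i. of_int (z i))"
    using x by (intro poly_mapping_eqI) (simp add: mem_Rn_iff)
  then show ?thesis using z that by blast
qed

lemma voronoi_cell_Lambda_iff:
  "x \<in> voronoi_cell (Lambda d a) \<longleftrightarrow> x \<in> span (Lambda d a) \<and>
    (\<forall>z. (\<forall>i<d. \<forall>j<d. [z i = z j] (mod int a)) \<longrightarrow>
      0 \<le> (\<Sum>i<d. (of_int (z i))\<^sup>2 - 2 * of_int (z i) * Poly_Mapping.lookup x i))"
proof (cases "x \<in> span (Lambda d a)")
  case True
  have "span (Lambda d a) \<subseteq> Rn d"
    by (intro span_minimal subspace_Rn) (auto simp: Lambda_def)
  then have x: "x \<in> Rn d" using True by blast
  have iff: "enorm x \<le> enorm (x - rvec_of d (\<lambda>i. of_int (z i))) \<longleftrightarrow>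
      0 \<le> (\<Sum>i<d. (of_int (z i))\<^sup>2 - 2 * of_int (z i) * Poly_Mapping.lookup x i)" for z
    unfolding enorm_le_iff[OF x rvec_of_in_Rn] by (intro arg_cong[where f = "(\<le>) 0"] sum.cong) simp_all
  show ?thesis
  proof
    assume "x \<in> voronoi_cell (Lambda d a)"
    then show "x \<in> span (Lambda d a) \<and> (\<forall>z. (\<forall>i<d. \<forall>j<d. [z i = z j] (mod int a)) \<longrightarrow>
      0 \<le> (\<Sum>i<d. (of_int (z i))\<^sup>2 - 2 * of_int (z i) * Poly_Mapping.lookup x i))"
      unfolding iff[symmetric] rvec_of_in_Lambda_iff[symmetric] by (simp add: voronoi_cell_def)
  next
    assume R: "x \<in> span (Lambda d a) \<and> (\<forall>z. (\<forall>i<d. \<forall>j<d. [z i = z j] (mod int a)) \<longrightarrow>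
      0 \<le> (\<Sum>i<d. (of_int (z i))\<^sup>2 - 2 * of_int (z i) * Poly_Mapping.lookup x i))"
    have "enorm x \<le> enorm (x - z)" if "z \<in> Lambda d a" for z
      using that
    proof (rule LambdaE)
      fix y assume "z = rvec_of d (\<lambda>i. of_int (y i))" "\<forall>i<d. \<forall>j<d. [y i = y j] (mod int a)"
      then show ?thesis using R iff by simp
    qed
    then show "x \<in> voronoi_cell (Lambda d a)"
      using True by (simp add: voronoi_cell_def)
  qed
qed (simp add: voronoi_cell_def)

text \<open>The lattice contains \<open>a\<close> times each unit vector. For \<open>a = 0\<close>
  it lies on the diagonal instead, so that case is treated separately.\<close>

lemma span_Lambda:
  assumes "a > 0"
  shows "span (Lambda d a) = Rn d"
proof
  show "span (Lambda d a) \<subseteq> Rn d"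
    by (intro span_minimal subspace_Rn) (auto simp: Lambda_def)
  show "Rn d \<subseteq> span (Lambda d a)"
  proof
    fix x assume x: "x \<in> Rn d"
    have mem: "rvec_of d (\<lambda>k. of_int (if k = i then int a else 0)) \<in> Lambda d a" for i
      unfolding rvec_of_in_Lambda_iff by (simp add: cong_def)
    have "rvec_of d (\<lambda>k. of_int (if k = i then int a else 0)) = real a *\<^sub>R Poly_Mapping.single i 1"
      if "i < d" for i
      using that by (intro poly_mapping_eqI) (auto simp: lookup_single when_def)
    then have single: "real a *\<^sub>R Poly_Mapping.single i 1 \<in> span (Lambda d a)" if "i < d" for i
      using mem[of i] that span_base by metis
    have "(Poly_Mapping.lookup x i / real a) *\<^sub>R real a *\<^sub>R Poly_Mapping.single i 1 \<in> span (Lambda d a)"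
      if "i < d" for i
      using span_scale[OF single[OF that]] .
    then have "Poly_Mapping.lookup x i *\<^sub>R Poly_Mapping.single i 1 \<in> span (Lambda d a)"
      if "i < d" for i
      using assms that by simp
    then have "(\<Sum>i<d. Poly_Mapping.lookup x i *\<^sub>R Poly_Mapping.single i 1) \<in> span (Lambda d a)"
      by (intro span_sum) simp
    then show "x \<in> span (Lambda d a)"
      using Rn_expansion[OF x] by simp
  qed
qed

section \<open>Reduction to finitely many cosets\<close>

text \<open>
  The function below is the least value of \<open>z\<^sup>2 - 2 z t\<close> over the two points \<open>z = k\<close> and
  \<open>z = k - a\<close> of the residue class of \<open>k\<close>.
\<close>

definition coset_min :: "real \<Rightarrow> real \<Rightarrow> real \<Rightarrow> real" where
  "coset_min a k t = min (k\<^sup>2 - 2 * k * t) ((k - a)\<^sup>2 - 2 * (k - a) * t)"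

text \<open>
  For \<open>m = j div 3\<close> fixed, these three values include all integers at distance at most \<open>1\<close> from
  \<open>m a / d\<close>.
\<close>

definition coset_rep :: "nat \<Rightarrow> nat \<Rightarrow> nat \<Rightarrow> int" where
  "coset_rep d a j = int (j div 3 * a div d) + int (j mod 3) - 1"

text \<open>The parabola \<open>z^2 - 2 z t\<close> has its vertex at \<open>t\<close>. Points of
  the residue class above \<open>k\<close> are at least as far from \<open>t\<close> as
  \<open>k\<close>, and points below \<open>k - a\<close> at least as far as \<open>k - a\<close>.
  The factorization \<open>(z - u) (z + u - 2 t)\<close> of the difference of two values makes this
  a sign check.\<close>

lemma coset_min_le:
  fixes k z :: int and a :: nat and t :: real
  assumes a: "a > 0" and k: "0 \<le> k" "k < int a" and z: "[z = k] (mod int a)"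
    and t: "- real a / 2 \<le> t" "t \<le> real a / 2"
  shows "coset_min a k t \<le> (of_int z)\<^sup>2 - 2 * of_int z * t"
proof -
  obtain q where q: "z = k + int a * q"
    using cong_sym[OF z] unfolding cong_iff_lin by blast
  consider "q = 0" | "q = - 1" | "q \<ge> 1" | "q \<le> - 2" by linarith
  then show ?thesis
  proof cases
    case 1
    then show ?thesis using q by (simp add: coset_min_def)
  next
    case 2
    then show ?thesis using q by (simp add: coset_min_def)
  next
    case 3
    have "int a * 1 \<le> int a * q" using 3 by (intro mult_left_mono) auto
    then have "k + int a \<le> z" using q by simp
    then have "real_of_int k + real a \<le> real_of_int z"
      by (metis of_int_add of_int_le_iff of_int_of_nat_eq)
    then have "0 \<le> (real_of_int z - k) * (real_of_int z + k - 2 * t)"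
      using k t by (intro mult_nonneg_nonneg) auto
    then show ?thesis
      by (simp add: coset_min_def min_le_iff_disj power2_eq_square algebra_simps)
  next
    case 4
    have "int a * q \<le> int a * (- 2)" using 4 by (intro mult_left_mono) auto
    then have "z \<le> k - 2 * int a" using q by simp
    then have "real_of_int z \<le> real_of_int (k - 2 * int a)" by (rule of_int_le_iff[THEN iffD2])
    then have le: "real_of_int z \<le> k - 2 * real a" by simp
    have "real_of_int k < real a" using k(2) by linarith
    then have "0 \<le> (real_of_int z - (k - real a)) * (real_of_int z + (k - real a) - 2 * t)"
      using le t by (intro mult_nonpos_nonpos) auto
    then have "(k - real a)\<^sup>2 - 2 * (k - real a) * t \<le> (of_int z)\<^sup>2 - 2 * of_int z * t"
      by (simp add: power2_eq_square algebra_simps)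
    then show ?thesis
      by (simp add: coset_min_def min_le_iff_disj)
  qed
qed

text \<open>The representatives \<open>0\<close> and \<open>a\<close> both have \<open>z = 0\<close>
  among their two candidates, so all summands are at most \<open>0\<close> and a nonnegative sum
  makes each of them vanish; this yields the cube. The representatives \<open>-1\<close> and
  \<open>1\<close> bound the coordinate sum through their first candidate.\<close>

lemma coset_rep_bounds:
  fixes x :: "nat \<Rightarrow> real"
  assumes d: "d > 0" and a: "a > 0"
    and nonneg: "\<And>j. j < 3 * (d + 1) \<Longrightarrow> 0 \<le> (\<Sum>i<d. coset_min a (coset_rep d a j) (x i))"
  shows "i < d \<Longrightarrow> - real a / 2 \<le> x i" "i < d \<Longrightarrow> x i \<le> real a / 2"
    and "\<bar>\<Sum>i<d. x i\<bar> \<le> real d / 2"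
proof -
  have nonpos: "f i = 0" if "\<And>i. f i \<le> 0" "0 \<le> (\<Sum>i<d. f i)" "i < d" for f :: "nat \<Rightarrow> real" and i
  proof -
    have "(\<Sum>i<d. - f i) = 0"
      using that(1,2) sum_nonpos[of "{..<d}" f] by (simp add: sum_negf)
    then show ?thesis
      using that(1,3) by (subst (asm) sum_nonneg_eq_0_iff) auto
  qed
  \<comment> \<open>The index \<open>1\<close> encodes \<open>k = 0\<close>; below, the indices
    \<open>0\<close> and \<open>2\<close> encode \<open>-1\<close> and \<open>1\<close>.\<close>
  have "0 \<le> (\<Sum>i<d. coset_min a 0 (x i))"
    using nonneg[of 1] by (simp add: coset_rep_def)
  then have "i < d \<Longrightarrow> coset_min a 0 (x i) = 0"
    by (rule nonpos[rotated]) (simp_all add: coset_min_def min_le_iff_disj)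
  then show "- real a / 2 \<le> x i" if "i < d"
  proof -
    have "0 \<le> coset_min a 0 (x i)"
      using that \<open>i < d \<Longrightarrow> coset_min a 0 (x i) = 0\<close> by simp
    then have "0 \<le> real a * (real a + 2 * x i)"
      by (simp add: coset_min_def power2_eq_square algebra_simps)
    then show ?thesis using a by (simp add: zero_le_mult_iff)
  qed
  \<comment> \<open>This index has \<open>m = d\<close> and offset \<open>0\<close>, hence encodes
    \<open>k = a\<close>.\<close>
  have "(3 * d + 1) div 3 = d" "(3 * d + 1) mod 3 = 1" by presburger+
  then have "0 \<le> (\<Sum>i<d. coset_min a a (x i))"
    using nonneg[of "3 * d + 1"] d by (simp add: coset_rep_def)
  then have "i < d \<Longrightarrow> coset_min a a (x i) = 0"
    by (rule nonpos[rotated]) (simp_all add: coset_min_def min_le_iff_disj)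
  then show "x i \<le> real a / 2" if "i < d"
  proof -
    have "0 \<le> coset_min a a (x i)"
      using that \<open>i < d \<Longrightarrow> coset_min a a (x i) = 0\<close> by simp
    then have "0 \<le> real a * (real a - 2 * x i)"
      by (simp add: coset_min_def power2_eq_square algebra_simps)
    then show ?thesis using a by (simp add: zero_le_mult_iff)
  qed
  have "0 \<le> (\<Sum>i<d. coset_min a (- 1) (x i))"
    using nonneg[of 0] by (simp add: coset_rep_def)
  also have "\<dots> \<le> (\<Sum>i<d. 1 + 2 * x i)"
    by (rule sum_mono) (simp add: coset_min_def)
  finally have 1: "0 \<le> real d + 2 * (\<Sum>i<d. x i)"
    by (simp add: sum.distrib sum_distrib_left)
  have "0 \<le> (\<Sum>i<d. coset_min a 1 (x i))"
    using nonneg[of 2] by (simp add: coset_rep_def)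
  also have "\<dots> \<le> (\<Sum>i<d. 1 - 2 * x i)"
    by (rule sum_mono) (simp add: coset_min_def)
  finally have 2: "0 \<le> real d - 2 * (\<Sum>i<d. x i)"
    by (simp add: sum_subtractf sum_distrib_left)
  show "\<bar>\<Sum>i<d. x i\<bar> \<le> real d / 2"
    using 1 2 by linarith
qed

text \<open>With \<open>q\<close> the floor of \<open>m a / d\<close>, an integer at distance at
  most \<open>1\<close> from \<open>m a / d\<close> is one of \<open>q - 1\<close>,
  \<open>q\<close>, \<open>q + 1\<close>, and the remainder of \<open>j\<close> modulo
  \<open>3\<close> selects which.\<close>

lemma coset_rep_surj:
  fixes k :: int
  assumes d: "d > 0" and m: "m \<le> d" and k: "\<bar>of_int k - real m * real a / real d\<bar> \<le> 1"
  shows "\<exists>j < 3 * (d + 1). coset_rep d a j = k"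
proof -
  define q where "q = m * a div d"
  have q: "real q \<le> real m * real a / real d" "real m * real a / real d < real q + 1"
    using floor_correct[of "real (m * a) / real d"]
    unfolding floor_divide_of_nat_eq by (simp_all add: q_def)
  have "real_of_int k < real q + 2" "real q - 1 \<le> real_of_int k"
    using q k by linarith+
  then have r: "int q - 1 \<le> k" "k \<le> int q + 1" by linarith+
  define j where "j = 3 * m + nat (k - int q + 1)"
  have "nat (k - int q + 1) < 3" using r by linarith
  then have "j div 3 = m" "j mod 3 = nat (k - int q + 1)" "j < 3 * (d + 1)"
    using m by (auto simp: j_def)
  then have "coset_rep d a j = k"
    using r by (simp add: coset_rep_def flip: q_def)
  then show ?thesis using \<open>j < 3 * (d + 1)\<close> by blast
qed

text \<open>
  Fixing which of the two candidates is used in each coordinate, say \<open>k - a\<close> in \<open>m\<close> of them, the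
  sum is a quadratic polynomial in \<open>k\<close> with vertex \<open>(m a + \<Sum>i. x i) / d\<close>. It only decreases when
  \<open>k\<close> is replaced by the integer closest to the vertex, which is one of the representatives, as the
  constraints for \<open>k = \<plusminus>1\<close> bound \<open>\<Sum>i. x i\<close> by \<open>d / 2\<close>.
\<close>

lemma coset_min_sum_nonneg:
  fixes x :: "nat \<Rightarrow> real" and k :: int
  assumes d: "d > 0" and a: "a > 0"
    and nonneg: "\<And>j. j < 3 * (d + 1) \<Longrightarrow> 0 \<le> (\<Sum>i<d. coset_min a (coset_rep d a j) (x i))"
  shows "0 \<le> (\<Sum>i<d. coset_min a k (x i))"
proof -
  define S where "S = {i\<in>{..<d}. (k - real a)\<^sup>2 - 2 * (k - real a) * x i \<le> k\<^sup>2 - 2 * k * x i}"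
  define m where "m = card S"
  define \<sigma> where "\<sigma> = (\<Sum>i<d. x i)"
  \<comment> \<open>The choice \<open>S\<close>, optimal at \<open>k\<close>, is frozen while
    \<open>t\<close> varies. So \<open>G\<close> is an upper bound for the sum of the
    \<open>coset_min\<close> values everywhere, with equality at \<open>t = k\<close>.\<close>
  define G where "G t = (\<Sum>i<d. if i \<in> S then (t - real a)\<^sup>2 - 2 * (t - real a) * x i
    else t\<^sup>2 - 2 * t * x i)" for t :: real
  have S: "S \<subseteq> {..<d}" by (auto simp: S_def)
  have m: "m \<le> d" using card_mono[OF _ S] by (simp add: m_def)
  define c where "c = (real m * real a + \<sigma>) / real d"
  have "G t = (\<Sum>i<d. t\<^sup>2 - 2 * t * x i + (if i \<in> S then (real a)\<^sup>2 - 2 * real a * t + 2 * real a * x i else 0))" for t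
    unfolding G_def by (rule sum.cong) (auto simp: power2_eq_square algebra_simps)
  also have "\<dots> t = real d * t\<^sup>2 - 2 * t * \<sigma> + (\<Sum>i\<in>S. (real a)\<^sup>2 - 2 * real a * t + 2 * real a * x i)" for t
    using S by (simp add: sum.distrib sum_subtractf \<sigma>_def sum_distrib_left
        sum.inter_restrict[symmetric] Int_absorb1)
  also have "\<dots> t = real d * t\<^sup>2 - 2 * t * (real m * real a + \<sigma>)
      + (real m * (real a)\<^sup>2 + 2 * real a * (\<Sum>i\<in>S. x i))" for t
    by (simp add: sum.distrib sum_subtractf sum_distrib_left sum_distrib_right m_def algebra_simps)
  also have "\<dots> t = real d * (t - c)\<^sup>2
      + (real m * (real a)\<^sup>2 + 2 * real a * (\<Sum>i\<in>S. x i) - real d * c\<^sup>2)" for t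
  proof -
    have "real m * real a + \<sigma> = real d * c" using d by (simp add: c_def)
    then show ?thesis by (simp add: power2_eq_square algebra_simps)
  qed
  finally have G: "G t = real d * (t - c)\<^sup>2
      + (real m * (real a)\<^sup>2 + 2 * real a * (\<Sum>i\<in>S. x i) - real d * c\<^sup>2)" for t .
  define r where "r = round c"
  have "\<bar>c - r\<bar> \<le> \<bar>c - k\<bar>"
    unfolding r_def by (rule round_diff_minimal)
  then have "(r - c)\<^sup>2 \<le> (k - c)\<^sup>2"
    by (metis abs_minus_commute abs_le_square_iff)
  then have "G r \<le> G k"
    unfolding G by (simp add: mult_left_mono)
  have "\<bar>\<sigma>\<bar> \<le> real d / 2"
    unfolding \<sigma>_def using coset_rep_bounds(3)[OF d a nonneg] .
  then have "\<bar>\<sigma> / real d\<bar> \<le> 1 / 2"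
    using d by (simp add: field_simps)
  moreover have "c = real m * real a / real d + \<sigma> / real d"
    by (simp add: c_def add_divide_distrib)
  moreover have "\<bar>of_int r - c\<bar> \<le> 1 / 2"
    unfolding r_def by (rule of_int_round_abs_le)
  ultimately have "\<bar>of_int r - real m * real a / real d\<bar> \<le> 1" by linarith
  then obtain j where "j < 3 * (d + 1)" "coset_rep d a j = r"
    using coset_rep_surj[OF d m] by blast
  then have "0 \<le> (\<Sum>i<d. coset_min a r (x i))"
    using nonneg by blast
  also have "\<dots> \<le> G r"
    unfolding G_def by (rule sum_mono) (simp add: coset_min_def)
  also have "\<dots> \<le> G k" by fact
  also have "\<dots> = (\<Sum>i<d. coset_min a k (x i))"
    unfolding G_def by (rule sum.cong) (auto simp: coset_min_def S_def)
  finally show ?thesis .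
qed

text \<open>In one direction, taking the better candidate in each coordinate gives a lattice point
  whose inequality is the one with \<open>coset_min\<close>. Conversely, \<open>coset_min\<close>
  bounds the summands of every lattice point of the coset from below, because the constraints
  already place \<open>x\<close> in the cube.\<close>

lemma voronoi_cell_Lambda:
  assumes d: "d > 0" and a: "a > 0"
  shows "voronoi_cell (Lambda d a) = {x \<in> Rn d. \<forall>j < 3 * (d + 1).
    0 \<le> (\<Sum>i<d. coset_min a (coset_rep d a j) (Poly_Mapping.lookup x i))}"
proof (intro set_eqI iffI)
  fix x assume x: "x \<in> voronoi_cell (Lambda d a)"
  have "0 \<le> (\<Sum>i<d. coset_min a k (Poly_Mapping.lookup x i))" for k :: int
  proof -
    let ?t = "Poly_Mapping.lookup x"
    define z where "z i = (if (of_int k)\<^sup>2 - 2 * of_int k * ?t i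
      \<le> (k - real a)\<^sup>2 - 2 * (k - real a) * ?t i then k else k - int a)" for i
    have "[z i = z j] (mod int a)" for i j
      by (auto simp: z_def cong_iff_dvd_diff)
    then have "0 \<le> (\<Sum>i<d. (of_int (z i))\<^sup>2 - 2 * of_int (z i) * ?t i)"
      using x unfolding voronoi_cell_Lambda_iff by blast
    also have "\<dots> = (\<Sum>i<d. coset_min a k (?t i))"
      by (rule sum.cong) (auto simp: z_def coset_min_def)
    finally show ?thesis .
  qed
  then show "x \<in> {x \<in> Rn d. \<forall>j < 3 * (d + 1).
    0 \<le> (\<Sum>i<d. coset_min a (coset_rep d a j) (Poly_Mapping.lookup x i))}"
    using x by (simp add: voronoi_cell_Lambda_iff span_Lambda[OF a])
next
  fix x assume "x \<in> {x \<in> Rn d. \<forall>j < 3 * (d + 1).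
    0 \<le> (\<Sum>i<d. coset_min a (coset_rep d a j) (Poly_Mapping.lookup x i))}"
  then have x: "x \<in> Rn d" and nonneg: "\<And>j. j < 3 * (d + 1) \<Longrightarrow>
    0 \<le> (\<Sum>i<d. coset_min a (coset_rep d a j) (Poly_Mapping.lookup x i))"
    by auto
  have "0 \<le> (\<Sum>i<d. (of_int (z i))\<^sup>2 - 2 * of_int (z i) * Poly_Mapping.lookup x i)"
    if z: "\<forall>i<d. \<forall>j<d. [z i = z j] (mod int a)" for z
  proof -
    \<comment> \<open>\<open>coset_min_le\<close> requires the residue between \<open>0\<close> and
      \<open>a - 1\<close>; coordinate \<open>0\<close> supplies it as \<open>d > 0\<close>.\<close>
    define k where "k = z 0 mod int a"
    have k: "0 \<le> k" "k < int a" using a by (auto simp: k_def)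
    have zk: "[z i = k] (mod int a)" if "i < d" for i
    proof -
      have "[z i = z 0] (mod int a)" using z that d by blast
      then show ?thesis by (simp add: k_def cong_def)
    qed
    have "0 \<le> (\<Sum>i<d. coset_min a k (Poly_Mapping.lookup x i))"
      by (rule coset_min_sum_nonneg[OF d a nonneg])
    also have "\<dots> \<le> (\<Sum>i<d. (of_int (z i))\<^sup>2 - 2 * of_int (z i) * Poly_Mapping.lookup x i)"
      using coset_rep_bounds(1,2)[OF d a nonneg] by (intro sum_mono coset_min_le[OF a k zk]) auto
    finally show ?thesis .
  qed
  then show "x \<in> voronoi_cell (Lambda d a)"
    using x by (simp add: voronoi_cell_Lambda_iff span_Lambda[OF a])
qed

section \<open>The degenerate case \<open>a = 0\<close>\<close>

lemma voronoi_cell_Lambda_0: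
  assumes d: "d > 0"
  shows "voronoi_cell (Lambda d 0) = (\<lambda>t. rvec_of d (\<lambda>_. t)) ` {- 1 / 2 .. 1 / 2}"
proof (intro equalityI subsetI)
  fix x assume x: "x \<in> voronoi_cell (Lambda d 0)"
  let ?D = "range (\<lambda>t. rvec_of d (\<lambda>_. t))"
  have sub: "subspace ?D"
    unfolding subspace_def
  proof (intro conjI ballI allI)
    show "0 \<in> ?D" by (rule range_eqI[of _ _ 0], rule poly_mapping_eqI) simp
    fix x y assume "x \<in> ?D" "y \<in> ?D"
    then obtain s t where "x = rvec_of d (\<lambda>_. s)" "y = rvec_of d (\<lambda>_. t)" by blast
    then show "x + y \<in> ?D"
      by (intro range_eqI[of _ _ "s + t"] poly_mapping_eqI) (simp add: lookup_add)
  next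
    fix c x assume "x \<in> ?D"
    then obtain s where "x = rvec_of d (\<lambda>_. s)" by blast
    then show "c *\<^sub>R x \<in> ?D"
      by (intro range_eqI[of _ _ "c * s"] poly_mapping_eqI) simp
  qed
  \<comment> \<open>Congruence modulo \<open>0\<close> is equality, so lattice points have constant
    coordinates.\<close>
  have "Lambda d 0 \<subseteq> ?D"
  proof
    fix y assume "y \<in> Lambda d 0"
    then obtain z where z: "y = rvec_of d (\<lambda>i. of_int (z i))" "\<forall>i<d. \<forall>j<d. [z i = z j] (mod int 0)"
      by (rule LambdaE)
    have "z i = z 0" if "i < d" for i
    proof -
      have "[z i = z 0] (mod int 0)" using z(2) that d by blast
      then show ?thesis by (simp add: cong_def)
    qed
    then obtain c where c: "\<And>i. i < d \<Longrightarrow> z i = c" by blast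
    have "y = rvec_of d (\<lambda>_. of_int c)"
      unfolding z(1) by (intro poly_mapping_eqI) (simp add: c)
    then show "y \<in> ?D" by blast
  qed
  from span_minimal[OF this sub] have "x \<in> ?D"
    using x by (auto simp: voronoi_cell_def)
  then obtain t where t: "x = rvec_of d (\<lambda>_. t)" by blast
  have "0 \<le> (\<Sum>i<d. (of_int c)\<^sup>2 - 2 * of_int c * Poly_Mapping.lookup x i)" for c :: int
    using x unfolding voronoi_cell_Lambda_iff by (elim conjE allE[of _ "\<lambda>_. c"]) simp
  moreover have "(\<Sum>i<d. (of_int c)\<^sup>2 - 2 * of_int c * Poly_Mapping.lookup x i) =
      (\<Sum>i<d. (of_int c)\<^sup>2 - 2 * of_int c * t)" for c :: int
    by (rule sum.cong) (simp_all add: t)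
  ultimately have "0 \<le> (\<Sum>i<d. (of_int c)\<^sup>2 - 2 * of_int c * t)" for c :: int
    by simp
  \<comment> \<open>The two lattice neighbours of the origin on the diagonal already cut out the
    segment.\<close>
  from this[of 1] this[of "- 1"] have "t \<in> {- 1 / 2 .. 1 / 2}"
    using d by (simp add: zero_le_mult_iff)
  then show "x \<in> (\<lambda>t. rvec_of d (\<lambda>_. t)) ` {- 1 / 2 .. 1 / 2}"
    using t by blast
next
  fix x assume "x \<in> (\<lambda>t. rvec_of d (\<lambda>_. t)) ` {- 1 / 2 .. 1 / 2}"
  then obtain t where t: "- 1 / 2 \<le> t" "t \<le> 1 / 2" "x = rvec_of d (\<lambda>_. t)" by auto
  have "x = t *\<^sub>R rvec_of d (\<lambda>_. of_int 1)"
    unfolding t by (rule poly_mapping_eqI) simp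
  then have "x \<in> span (Lambda d 0)"
    using rvec_of_in_Lambda_iff[of d "\<lambda>_. 1" 0] by (simp add: span_base span_scale)
  moreover have "0 \<le> (\<Sum>i<d. (of_int (z i))\<^sup>2 - 2 * of_int (z i) * Poly_Mapping.lookup x i)" for z
  proof (rule sum_nonneg)
    fix i assume "i \<in> {..<d}"
    \<comment> \<open>Each summand is nonnegative by itself: an integer satisfies
      \<open>|z| <= z^2\<close>, and \<open>|2 t| <= 1\<close>.\<close>
    have "\<bar>z i\<bar> * 1 \<le> \<bar>z i\<bar> * \<bar>z i\<bar>"
    proof (cases "z i = 0")
      case False
      then have "1 \<le> \<bar>z i\<bar>" by linarith
      then show ?thesis by (rule mult_left_mono) simp
    qed simp
    then have "real_of_int (\<bar>z i\<bar> * 1) \<le> real_of_int (\<bar>z i\<bar> * \<bar>z i\<bar>)"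
      by (rule of_int_le_iff[THEN iffD2])
    then have sq: "\<bar>real_of_int (z i)\<bar> \<le> (real_of_int (z i))\<^sup>2"
      by (simp add: power2_eq_square)
    have "2 * of_int (z i) * t \<le> \<bar>2 * t\<bar> * \<bar>real_of_int (z i)\<bar>"
      by (metis abs_ge_self abs_mult mult.assoc mult.commute)
    also have "\<dots> \<le> 1 * \<bar>real_of_int (z i)\<bar>"
      using t by (intro mult_right_mono) auto
    finally show "0 \<le> (of_int (z i))\<^sup>2 - 2 * of_int (z i) * Poly_Mapping.lookup x i"
      using sq \<open>i \<in> {..<d}\<close> by (simp add: t(3))
  qed
  ultimately show "x \<in> voronoi_cell (Lambda d 0)"
    unfolding voronoi_cell_Lambda_iff by blast
qed

text \<open>The lift is the interval from \<open>-1/2\<close> to \<open>1/2\<close> in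
  \<open>Rn 1\<close>, whose two bounds are the constraints for \<open>s = 1\<close> and
  \<open>s = - 1\<close>.\<close>

lemma xc_voronoi_cell_Lambda_0:
  assumes d: "d > 0"
  shows "xc (voronoi_cell (Lambda d 0)) \<le> enat 2"
proof -
  define \<phi> where "\<phi> s x = s * Poly_Mapping.lookup x 0" for s :: real and x :: rvec
  let ?f = "\<lambda>x :: rvec. rvec_of d (\<lambda>_. Poly_Mapping.lookup x 0)"
  let ?Q = "{x \<in> Rn 1. \<forall>s\<in>{1, - 1}. \<phi> s x \<le> 1 / 2}"
  have lin: "linear (\<phi> s)" for s
    unfolding \<phi>_def by (rule linearI) (simp_all add: lookup_add algebra_simps)
  have linf: "linear ?f"
    by (rule linear_rvec_of) (rule linear_lookup)
  have "voronoi_cell (Lambda d 0) = ?f ` ?Q"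
    unfolding voronoi_cell_Lambda_0[OF d]
  proof (intro equalityI subsetI)
    fix x assume "x \<in> (\<lambda>t. rvec_of d (\<lambda>_. t)) ` {- 1 / 2 .. 1 / 2}"
    then obtain t where "t \<in> {- 1 / 2 .. 1 / 2}" "x = rvec_of d (\<lambda>_. t)" by blast
    then show "x \<in> ?f ` ?Q"
      by (intro image_eqI[of _ _ "rvec_of 1 (\<lambda>_. t)"]) (auto simp: \<phi>_def)
  next
    fix x assume "x \<in> ?f ` ?Q"
    then show "x \<in> (\<lambda>t. rvec_of d (\<lambda>_. t)) ` {- 1 / 2 .. 1 / 2}"
      by (auto simp: \<phi>_def)
  qed
  from xc_le_card[OF _ lin linf this] show ?thesis by (simp add: numeral_2_eq_2)
qed

section \<open>The lift for \<open>a > 0\<close> and the cubic bound\<close>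

text \<open>
  In the lift, coordinate \<open>(j + 1) d + i\<close> is a lower bound for the \<open>i\<close>-th summand of the \<open>j\<close>-th
  constraint on the coordinates \<open>0, \<dots>, d - 1\<close>.
\<close>

lemma xc_voronoi_cell_Lambda:
  assumes d: "d > 0" and a: "a > 0"
  shows "xc (voronoi_cell (Lambda d a)) \<le> enat (3 * (d + 1) * (2 * d + 1))"
proof -
  define N where "N = 3 * (d + 1)"
  define n where "n = (N + 1) * d"
  define k where "k j = real_of_int (coset_rep d a j)" for j
  define Y where "Y j i w = Poly_Mapping.lookup w ((j + 1) * d + i)" for j i and w :: rvec
  \<comment> \<open>The rows \<open>p < d\<close> and \<open>d <= p < 2 d\<close> put
    \<open>Y j i\<close> below the first and the second candidate, and \<open>p = 2 d\<close> makes
    the sum over \<open>i\<close> nonnegative. The squares go into \<open>b\<close>, since the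
    left-hand sides have to be linear.\<close>
  define \<phi> where "\<phi> = (\<lambda>(j, p) w.
    if p < d then Y j p w + 2 * k j * Poly_Mapping.lookup w p
    else if p < 2 * d then Y j (p - d) w + 2 * (k j - real a) * Poly_Mapping.lookup w (p - d)
    else - (\<Sum>i<d. Y j i w))"
  define b where "b = (\<lambda>(j, p). if p < d then (k j)\<^sup>2 else if p < 2 * d then (k j - real a)\<^sup>2 else 0)"
  define I where "I = {..<N} \<times> {..<2 * d + 1}"
  let ?f = "\<lambda>w :: rvec. rvec_of d (Poly_Mapping.lookup w)"
  let ?Q = "{w \<in> Rn n. \<forall>i\<in>I. \<phi> i w \<le> b i}"
  have linf: "linear ?f"
    by (rule linear_rvec_of) (rule linear_lookup)
  have lin: "linear (\<phi> jp)" for jp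
  proof -
    obtain j p where jp: "jp = (j, p)" by (cases jp)
    show ?thesis unfolding \<phi>_def jp Y_def
      by (rule linearI)
        (simp_all add: lookup_add sum.distrib sum_distrib_left distrib_left)
  qed
  have Q_iff: "w \<in> ?Q \<longleftrightarrow> w \<in> Rn n \<and> (\<forall>j<N.
      (\<forall>i<d. Y j i w \<le> coset_min a (k j) (Poly_Mapping.lookup w i)) \<and> 0 \<le> (\<Sum>i<d. Y j i w))" for w
  proof -
    have all3: "(\<forall>p<2 * d + 1. P p) \<longleftrightarrow> (\<forall>i<d. P i) \<and> (\<forall>i<d. P (d + i)) \<and> P (2 * d)" for P
    proof (intro iffI conjI allI impI)
      fix p assume P: "(\<forall>i<d. P i) \<and> (\<forall>i<d. P (d + i)) \<and> P (2 * d)" and "p < 2 * d + 1"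
      then consider "p < d" | "d \<le> p" "p - d < d" | "p = 2 * d" by linarith
      then show "P p"
      proof cases
        case 2
        then have "P (d + (p - d))" using P by blast
        then show ?thesis using 2 by simp
      qed (use P in auto)
    qed auto
    have "(\<forall>i\<in>I. \<phi> i w \<le> b i) \<longleftrightarrow> (\<forall>j<N. \<forall>p<2 * d + 1. \<phi> (j, p) w \<le> b (j, p))"
      by (auto simp: I_def)
    also have "\<dots> \<longleftrightarrow> (\<forall>j<N. (\<forall>i<d. Y j i w \<le> coset_min a (k j) (Poly_Mapping.lookup w i))
        \<and> 0 \<le> (\<Sum>i<d. Y j i w))"
      unfolding all3 by (auto simp: \<phi>_def b_def coset_min_def algebra_simps)
    finally show ?thesis by simp
  qed
  have "voronoi_cell (Lambda d a) = ?f ` ?Q"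
  proof (intro equalityI subsetI)
    fix x assume x: "x \<in> voronoi_cell (Lambda d a)"
    \<comment> \<open>The preimage takes the largest admissible values
      \<open>Y j i = coset_min\<close>. The \<open>- 1\<close> undoes the shift by the first block,
      which holds \<open>x\<close>.\<close>
    define w where "w = rvec_of n (\<lambda>p. if p < d then Poly_Mapping.lookup x p
      else coset_min a (k (p div d - 1)) (Poly_Mapping.lookup x (p mod d)))"
    have n: "(j + 1) * d + i < n" if "j < N" "i < d" for i j
    proof -
      have "(j + 1) * d + i < (j + 2) * d" using that(2) by simp
      also have "\<dots> \<le> n" unfolding n_def using that(1) by (intro mult_right_mono) auto
      finally show ?thesis .
    qed
    have wx: "Poly_Mapping.lookup w i = Poly_Mapping.lookup x i" if "i < d" for i
      using that by (simp add: w_def n_def)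
    have wY: "Y j i w = coset_min a (k j) (Poly_Mapping.lookup x i)" if "j < N" "i < d" for i j
    proof -
      let ?p = "(j + 1) * d + i"
      have p: "?p div d = j + 1" "?p mod d = i"
        using that(2) by (simp_all only: div_mult_self3 mod_mult_self3) simp_all
      have "Y j i w = coset_min a (k (?p div d - 1)) (Poly_Mapping.lookup x (?p mod d))"
        using n[OF that] by (simp add: Y_def w_def)
      then show ?thesis unfolding p by simp
    qed
    have "w \<in> ?Q"
      unfolding Q_iff using x
      by (simp add: wx wY voronoi_cell_Lambda[OF d a] N_def k_def) (simp add: w_def)
    moreover have "x = ?f w"
      using x by (intro poly_mapping_eqI) (simp add: wx voronoi_cell_Lambda[OF d a] mem_Rn_iff)
    ultimately show "x \<in> ?f ` ?Q" by blast
  next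
    fix x assume "x \<in> ?f ` ?Q"
    then obtain w where w: "w \<in> ?Q" "x = ?f w" by blast
    have "0 \<le> (\<Sum>i<d. coset_min a (k j) (Poly_Mapping.lookup x i))" if "j < N" for j
    proof -
      have "0 \<le> (\<Sum>i<d. Y j i w)"
        using w(1) that unfolding Q_iff by blast
      also have "\<dots> \<le> (\<Sum>i<d. coset_min a (k j) (Poly_Mapping.lookup x i))"
        using w(1) that unfolding Q_iff by (intro sum_mono) (simp add: w(2))
      finally show ?thesis .
    qed
    then show "x \<in> voronoi_cell (Lambda d a)"
      by (simp add: voronoi_cell_Lambda[OF d a] w(2) N_def k_def)
  qed
  from xc_le_card[OF _ lin linf this] show ?thesis
    by (simp add: I_def N_def card_cartesian_product)
qed

theorem theorem17:
  shows "\<exists>C :: nat. \<forall>a d :: nat. d \<ge> 1 \<longrightarrow> xc (voronoi_cell (Lambda d a)) \<le> enat (C * d ^ 3)"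
proof (intro exI allI impI)
  fix a d :: nat assume d: "d \<ge> 1"
  have "d * d * 1 \<le> d * d * d" using d by (intro mult_left_mono) auto
  \<comment> \<open>Multiplied by \<open>3\<close> this gives \<open>18 d^2\<close>, where the
    constant \<open>18\<close> comes from.\<close>
  have "(d + 1) * (2 * d + 1) \<le> (2 * d) * (3 * d)"
    using d by (intro mult_mono) auto
  then have le: "3 * (d + 1) * (2 * d + 1) \<le> 18 * d ^ 3"
    using \<open>d * d * 1 \<le> d * d * d\<close> unfolding power3_eq_cube by linarith
  show "xc (voronoi_cell (Lambda d a)) \<le> enat (18 * d ^ 3)"
  proof (cases "a = 0")
    case True
    have "1 \<le> d ^ 3" using d by simp
    have "xc (voronoi_cell (Lambda d 0)) \<le> enat 2"
      using d by (intro xc_voronoi_cell_Lambda_0) simp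
    also have "\<dots> \<le> enat (18 * d ^ 3)"
      using \<open>1 \<le> d ^ 3\<close> by simp
    finally show ?thesis
      unfolding True .
  next
    case False
    then have "xc (voronoi_cell (Lambda d a)) \<le> enat (3 * (d + 1) * (2 * d + 1))"
      using d by (intro xc_voronoi_cell_Lambda) auto
    also have "\<dots> \<le> enat (18 * d ^ 3)"
      using le by simp
    finally show ?thesis .
  qed
qed

end
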